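(* For any integers $k\geq 1$ and $m\geq 2$, the graph $C_{4k}\times P_m$ admits a $2(2m-1)$-divisible graceful $\alpha$-labeling.
   Context: $C_n$ ($n\ge 3$) is the cycle on $n$ vertices and $P_m$ ($m\ge 2$) is the path on $m$ vertices. $C_n\times P_m$ denotes their Cartesian product (the grid on a cylinder): its vertices are the pairs $(i,j)$ with $1\le i\le m$, $1\le j\le n$, and its edges are $[(i,j),(i,j+1)]$ (with $j$ taken modulo $n$) for $1\le i\le m$, and $[(i,j),(i+1,j)]$ for $1\le i\le m-1$. The graph $C_{4k}\times P_m$ is bipartite and has $4k(2m-1)$ edges. The size of a graph is its number of edges. Let $\Gamma$ be a graph of size $e=d\cdot q$ with $d,q$ positive integers. A $d$-divisible graceful labeling of $\Gamma$ is an injective function $f:V(\Gamma)\to\{0,1,2,\ldots,d(q+1)-1\}$ such that $$\{|f(x)-f(y)| : [x,y]\in E(\Gamma)\}=\{1,2,3,\ldots,d(q+1)\}\setminus\{q+1,2(q+1),\ldots,d(q+1)\}.$$ If $\Gamma$ is bipartite, a $d$-divisible graceful $\alpha$-labeling of $\Gamma$ is a $d$-divisible graceful labeling $f$ of $\Gamma$ such that the maximum value of $f$ on one of the two bipartite sets is strictly less than its minimum value on the other one. *)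

theory Defs
  imports Main
begin

text \<open>A graph is a vertex set together with a set of edges, each edge being the set of its
  two end vertices.\<close>

definition simple_graph :: "'a set \<Rightarrow> 'a set set \<Rightarrow> bool" where
  "simple_graph V E \<longleftrightarrow> finite V \<and> (\<forall>e\<in>E. e \<subseteq> V \<and> card e = 2)"

definition bipartition :: "'a set \<Rightarrow> 'a set set \<Rightarrow> 'a set \<Rightarrow> 'a set \<Rightarrow> bool" where
  "bipartition V E A B \<longleftrightarrow>
     A \<union> B = V \<and> A \<inter> B = {} \<and> (\<forall>e\<in>E. \<exists>a\<in>A. \<exists>b\<in>B. e = {a, b})"

definition divisible_graceful_labeling ::
    "nat \<Rightarrow> 'a set \<Rightarrow> 'a set set \<Rightarrow> ('a \<Rightarrow> nat) \<Rightarrow> bool" where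
  "divisible_graceful_labeling d V E f \<longleftrightarrow>
     simple_graph V E \<and> d > 0 \<and>
     (\<exists>q>0. card E = d * q \<and>
        inj_on f V \<and> f ` V \<subseteq> {0..d * (q + 1) - 1} \<and>
        {\<bar>int (f x) - int (f y)\<bar> | x y. {x, y} \<in> E} =
          int ` ({1..d * (q + 1)} - {i * (q + 1) | i. i \<in> {1..d}}))"

text \<open>The sets whose maximum and minimum are taken are finite and nonempty, since the graph is
  finite and has \<open>d * q > 0\<close> edges. Which of the two parts carries the smaller labels is left
  open, as \<open>bipartition\<close> is symmetric in its last two arguments.\<close>

definition divisible_graceful_alpha_labeling ::
    "nat \<Rightarrow> 'a set \<Rightarrow> 'a set set \<Rightarrow> ('a \<Rightarrow> nat) \<Rightarrow> bool" where
  "divisible_graceful_alpha_labeling d V E f \<longleftrightarrow>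
     divisible_graceful_labeling d V E f \<and>
     (\<exists>A B. bipartition V E A B \<and> Max (f ` A) < Min (f ` B))"

text \<open>The product of the cycle on \<open>n\<close> vertices and the path on \<open>m\<close> vertices: in a vertex
  \<open>(i, j)\<close>, \<open>i\<close> is the position on the path and \<open>j\<close> the position on the cycle. As positions
  start at 1, the successor of \<open>j\<close> on the cycle is \<open>j mod n + 1\<close>.\<close>

definition cycle_path_verts :: "nat \<Rightarrow> nat \<Rightarrow> (nat \<times> nat) set" where
  "cycle_path_verts n m = {1..m} \<times> {1..n}"

definition cycle_path_edges :: "nat \<Rightarrow> nat \<Rightarrow> (nat \<times> nat) set set" where
  "cycle_path_edges n m =
     {{(i, j), (i, j mod n + 1)} | i j. i \<in> {1..m} \<and> j \<in> {1..n}} \<union>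
     {{(i, j), (i + 1, j)} | i j. i \<in> {1..m - 1} \<and> j \<in> {1..n}}"

lemma simple_graph_cycle_path:
  assumes "n \<ge> 3"
  shows "simple_graph (cycle_path_verts n m) (cycle_path_edges n m)"
proof -
  have *: "j mod n + 1 \<noteq> j" "j mod n + 1 \<le> n" if "1 \<le> j" "j \<le> n" for j
    using that assms by (cases "j = n"; simp)+
  have **: "j \<noteq> Suc (j mod n)" "Suc (j mod n) \<le> n" if "1 \<le> j" "j \<le> n" for j
    using *[OF that] by linarith+
  show ?thesis
    unfolding simple_graph_def cycle_path_verts_def cycle_path_edges_def
    using ** by (auto simp: card_insert_if)
qed

lemma card_cycle_path_edges:
  assumes "n \<ge> 3" "m \<ge> 1"
  shows "card (cycle_path_edges n m) = n * (2 * m - 1)"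
proof -
  let ?h = "\<lambda>(i, j). {(i, j), (i, j mod n + 1)} :: (nat \<times> nat) set"
  let ?v = "\<lambda>(i, j). {(i, j), (i + 1, j)} :: (nat \<times> nat) set"
  have E: "cycle_path_edges n m = ?h ` ({1..m} \<times> {1..n}) \<union> ?v ` ({1..m - 1} \<times> {1..n})"
    unfolding cycle_path_edges_def by (force simp: image_iff)
  have no_2cycle: "\<not> (j = Suc (j' mod n) \<and> Suc (j mod n) = j')"
    if "1 \<le> j" "j \<le> n" "1 \<le> j'" "j' \<le> n" for j j'
  proof -
    have mod: "x mod n = (if x = n then 0 else x)" if "x \<le> n" for x
      using that by simp
    show ?thesis
      unfolding mod[OF that(2)] mod[OF that(4)] using that assms by (auto split: if_splits)
  qed
  have h: "inj_on ?h ({1..m} \<times> {1..n})"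
  proof (rule inj_onI, clarify)
    fix i j i' j'
    assume bounds: "i \<in> {1..m}" "j \<in> {1..n}" "i' \<in> {1..m}" "j' \<in> {1..n}"
      and eq: "{(i, j), (i, j mod n + 1)} = {(i', j'), (i', j' mod n + 1)}"
    have "i = i' \<and> (j = j' \<or> j = Suc (j' mod n) \<and> Suc (j mod n) = j')"
      using eq unfolding doubleton_eq_iff prod.inject Suc_eq_plus1 by metis
    then show "i = i' \<and> j = j'"
      using no_2cycle[of j j'] bounds by (metis Suc_eq_plus1 atLeastAtMost_iff)
  qed
  have v: "inj_on ?v ({1..m - 1} \<times> {1..n})"
    by (auto simp: inj_on_def doubleton_eq_iff)
  have "?h ` ({1..m} \<times> {1..n}) \<inter> ?v ` ({1..m - 1} \<times> {1..n}) = {}"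
    by (auto simp: doubleton_eq_iff)
  then have "card (cycle_path_edges n m) =
      card (?h ` ({1..m} \<times> {1..n})) + card (?v ` ({1..m - 1} \<times> {1..n}))"
    unfolding E by (intro card_Un_disjoint finite_imageI finite_cartesian_product
      finite_atLeastAtMost)
  also have "\<dots> = m * n + (m - 1) * n"
    unfolding card_image[OF h] card_image[OF v] by simp
  also have "\<dots> = n * (2 * m - 1)"
    using assms by (cases m) (auto simp: algebra_simps)
  finally show ?thesis .
qed

end

theory Submission imports Defs begin

text \<open>
  Put \<open>Q = 2k + 1\<close> and \<open>M = dQ = 2(2m - 1)Q\<close>. Going once around a cycle of length \<open>4k\<close>, take
  alternately low labels \<open>0, 1, 2, \<dots>\<close> and high labels \<open>M - 1, M - 2, \<dots>\<close>, the latter lowered by 2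
  in the second half; the differences along the edges are then \<open>M - s\<close> for
  \<open>s = 1, \<dots>, 2k, 2k + 3, \<dots>, 4k + 1\<close>, and \<open>s = 2k + 2\<close> for the closing edge.

  Every further copy of the cycle carries the same pattern rotated by one position, with the low
  labels raised and the high labels lowered by another \<open>2Q\<close>. Because of the rotation, the edges
  joining two consecutive copies see the same \<open>s\<close> as the edges of a cycle. So the cycles and
  the \<open>m - 1\<close> sets of joining edges give the differences \<open>M - 2Qr - s\<close> for \<open>r = 0, \<dots>, 2m - 2\<close>,
  and these are all the numbers up to \<open>M\<close> that are not multiples of \<open>Q\<close>.
\<close>

section \<open>Labels along one cycle\<close>

definition zigzag :: "nat \<Rightarrow> nat \<Rightarrow> nat \<Rightarrow> nat \<Rightarrow> nat" where
  "zigzag k M a p =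
     (if even p then a + p div 2 else M - 1 - a - p div 2 - (if p < 2 * k then 0 else 2))"

definition zigzag_gap :: "nat \<Rightarrow> nat \<Rightarrow> nat" where
  "zigzag_gap k p = (if p < 2 * k then p + 1 else if p < 4 * k - 1 then p + 3 else 2 * k + 2)"

text \<open>Two separate offsets let one computation serve both the edges of a cycle
  (\<open>a = b\<close>) and the joining edges. The gap is at most \<open>4 * k + 1\<close>, so the
  bound keeps the difference positive and every subtraction untruncated.\<close>

lemma zigzag_diff:
  assumes "p < 4 * k" "a + b + 2 * (2 * k + 1) \<le> M"
  shows "\<bar>int (zigzag k M a p) - int (zigzag k M b ((p + 1) mod (4 * k)))\<bar> =
    int (M - (a + b) - zigzag_gap k p)"
proof (cases "even p")
  case True
  then obtain t where p: "p = 2 * t" by blast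
  have "(p + 1) mod (4 * k) = 2 * t + 1" using p assms(1) by simp
  then show ?thesis using p assms by (auto simp: zigzag_def zigzag_gap_def)
next
  case False
  then obtain t where p: "p = 2 * t + 1" by (blast elim: oddE)
  show ?thesis
  proof (cases "p + 1 = 4 * k")
    case True
    then have "(p + 1) mod (4 * k) = 0" by simp
    then show ?thesis using p True assms by (auto simp: zigzag_def zigzag_gap_def)
  next
    case False
    then have "(p + 1) mod (4 * k) = 2 * (t + 1)" using p assms(1) by simp
    then show ?thesis using p False assms by (auto simp: zigzag_def zigzag_gap_def)
  qed
qed

text \<open>Stated as a sum so that no truncated subtraction occurs.\<close>

lemma zigzag_odd:
  assumes "odd p" "p < 4 * k" "a + 2 * (2 * k + 1) \<le> M"
  shows "zigzag k M a p + a + p div 2 + (if p < 2 * k then 1 else 3) = M"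
  using assms by (auto simp: zigzag_def elim!: oddE)

text \<open>The two halves cannot collide: the shifted values are at most \<open>k\<close> in the
  first half and at least \<open>k + 3\<close> in the second.\<close>

lemma odd_position_eq:
  fixes p p' k :: nat
  assumes "odd p" "odd p'"
    and "p div 2 + (if p < 2 * k then 1 else 3) = p' div 2 + (if p' < 2 * k then 1 else 3)"
  shows "p = p'"
  using assms by (auto split: if_splits elim!: oddE)

lemma zigzag_gap_image:
  assumes "k \<ge> 1"
  shows "zigzag_gap k ` {..<4 * k} = {1..4 * k + 1} - {2 * k + 1}"
proof (intro equalityI subsetI)
  fix s assume s: "s \<in> {1..4 * k + 1} - {2 * k + 1}"
  let ?p = "if s \<le> 2 * k then s - 1 else if s = 2 * k + 2 then 4 * k - 1 else s - 3"
  have "s = zigzag_gap k ?p" "?p < 4 * k"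
    using s assms by (auto simp: zigzag_gap_def)
  then show "s \<in> zigzag_gap k ` {..<4 * k}" by blast
qed (auto simp: zigzag_gap_def)

section \<open>Numbers not divisible by Q\<close>

text \<open>Division of \<open>2 * N * Q - v\<close> by \<open>2 * Q\<close> yields quotient
  \<open>r\<close> and remainder \<open>s\<close>. As \<open>Q\<close> divides the total, it divides
  \<open>v\<close> iff it divides \<open>s\<close>, that is, iff \<open>s\<close> is 0 or
  \<open>Q\<close>.\<close>

lemma non_multiples_eq:
  fixes Q N :: nat
  assumes "Q > 0"
  shows "{2 * N * Q - 2 * Q * r - s | r s. r < N \<and> s \<in> {1..2 * Q - 1} - {Q}} =
    {1..2 * N * Q} - {i * Q | i. i \<in> {1..2 * N}}" (is "?L = ?R")
proof (intro equalityI subsetI)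
  fix v assume "v \<in> ?L"
  then obtain r s where v: "v = 2 * N * Q - 2 * Q * r - s" and r: "r < N"
    and s: "1 \<le> s" "s < 2 * Q" "s \<noteq> Q" by auto
  have "2 * Q * (r + 1) \<le> 2 * Q * N" using r by (intro mult_le_mono2) simp
  then have sum: "v + 2 * Q * r + s = 2 * N * Q" and "v \<ge> 1"
    using v s by (simp_all add: algebra_simps)
  have "\<not> Q dvd v"
  proof
    assume "Q dvd v"
    moreover have "Q dvd v + 2 * Q * r + s" unfolding sum by simp
    ultimately have "Q dvd s" by (simp add: dvd_add_right_iff add.assoc)
    then obtain c where "s = Q * c" by blast
    moreover from this have "c < 2" using s(2) by (simp add: mult.commute)
    ultimately show False using s by (cases c) auto
  qed
  then show "v \<in> ?R" using sum \<open>v \<ge> 1\<close> by auto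
next
  fix v assume v: "v \<in> ?R"
  then have v1: "1 \<le> v" "v \<le> 2 * N * Q" by auto
  have ndvd: "\<not> Q dvd v"
  proof
    assume "Q dvd v"
    then obtain i where i: "v = i * Q" by (metis dvd_div_mult_self)
    then have "i * Q \<le> 2 * N * Q" using v1 by (simp add: ac_simps)
    then have "i \<le> 2 * N" using assms by simp
    moreover have "i \<noteq> 0" using i v1 by auto
    ultimately have "i \<in> {1..2 * N}" by simp
    then show False using v i by blast
  qed
  define w where "w = 2 * N * Q - v"
  define r where "r = w div (2 * Q)"
  define s where "s = w mod (2 * Q)"
  have w: "w = 2 * Q * r + s" unfolding r_def s_def by simp
  have "r < N"
    unfolding r_def w_def using v1 assms by (intro less_mult_imp_div_less) (simp add: ac_simps)
  moreover have sum: "v + 2 * Q * r + s = 2 * N * Q"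
    using w v1 unfolding w_def by linarith
  moreover have "s < 2 * Q" unfolding s_def using assms by simp
  moreover have "\<not> Q dvd s"
  proof
    assume "Q dvd s"
    moreover have "Q dvd v + (2 * Q * r + s)" using sum by (simp add: add.assoc)
    ultimately show False using ndvd by (simp add: dvd_add_left_iff)
  qed
  moreover from this have "s \<noteq> 0" "s \<noteq> Q" by (metis dvd_0_right dvd_refl)+
  moreover have "v = 2 * N * Q - 2 * Q * r - s" using sum by linarith
  ultimately show "v \<in> ?L" by force
qed

section \<open>Rotated positions on the cycle\<close>

lemma ex_cycle_position:
  fixes n p i :: nat
  assumes "p < n"
  shows "\<exists>j\<in>{1..n}. (i + j) mod n = p"
proof -
  \<comment> \<open>This represents \<open>p - i\<close> modulo \<open>n\<close> by a number between
    1 and \<open>2 * n - 1\<close>; subtracting \<open>n\<close> when it is too large gives a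
    column.\<close>
  let ?x = "p + (n - i mod n)"
  have "i mod n < n" using assms by simp
  have "(i + ?x) mod n = (i mod n + ?x) mod n" by (simp add: mod_add_left_eq)
  also have "i mod n + ?x = p + n" using \<open>i mod n < n\<close> by linarith
  finally have x: "(i + ?x) mod n = p" using assms by simp
  show ?thesis
  proof (cases "?x \<le> n")
    case True
    then show ?thesis using x \<open>i mod n < n\<close> by (intro bexI[of _ ?x]) auto
  next
    case False
    have "i + ?x = i + (?x - n) + n" using False by simp
    then have "(i + (?x - n)) mod n = p" using x by (metis mod_add_self2)
    then show ?thesis using False assms by (intro bexI[of _ "?x - n"]) auto
  qed
qed

lemma cycle_position_inj:
  fixes n i j j' :: nat
  assumes "j \<in> {1..n}" "j' \<in> {1..n}" "(i + j) mod n = (i + j') mod n"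
  shows "j = j'"
  using assms
proof (induction j j' rule: linorder_wlog)
  case (le j j')
  then have "n dvd (i + j') - (i + j)"
    using mod_eq_dvd_iff_nat[of "i + j" "i + j'" n] by simp
  then have "n dvd j' - j" by simp
  then show ?case using le dvd_imp_le[of n "j' - j"] by force
qed auto

section \<open>The labeling, its cut and its injectivity\<close>

text \<open>Both neighbours \<open>(i, j + 1)\<close> and \<open>(i + 1, j)\<close> sit one position
  after \<open>(i, j)\<close>. As \<open>4 * k\<close> is even, the parity of \<open>i + j\<close>
  decides between low and high labels.\<close>

definition cylinder_label :: "nat \<Rightarrow> nat \<Rightarrow> nat \<times> nat \<Rightarrow> nat" where
  "cylinder_label k m = (\<lambda>(i, j). zigzag k (2 * (2 * m - 1) * (2 * k + 1))
     (2 * (2 * k + 1) * (i - 1)) ((i + j) mod (4 * k)))"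

lemma cylinder_label_even:
  assumes "even (i + j)"
  shows "cylinder_label k m (i, j) = 2 * (2 * k + 1) * (i - 1) + (i + j) mod (4 * k) div 2"
  using assms by (simp add: cylinder_label_def zigzag_def dvd_mod_iff)

text \<open>Supplies the bound required by \<open>zigzag_diff\<close> and \<open>zigzag_odd\<close>,
  with \<open>c = 2 * m - 1\<close>.\<close>

lemma mult_add_le:
  fixes a b c Q :: nat
  assumes "a + b + 1 \<le> c"
  shows "2 * Q * a + 2 * Q * b + 2 * Q \<le> 2 * c * Q"
proof -
  have "2 * Q * (a + b + 1) \<le> 2 * Q * c" using assms by (intro mult_le_mono2)
  then show ?thesis by (simp add: algebra_simps)
qed

lemma cylinder_label_odd:
  assumes "odd (i + j)" "i \<in> {1..m}" "k \<ge> 1"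
  shows "cylinder_label k m (i, j) + 2 * (2 * k + 1) * (i - 1) + (i + j) mod (4 * k) div 2 +
    (if (i + j) mod (4 * k) < 2 * k then 1 else 3) = 2 * (2 * k + 1) * (2 * m - 1)"
proof -
  have p: "odd ((i + j) mod (4 * k))" "(i + j) mod (4 * k) < 4 * k"
    using assms by (simp_all add: dvd_mod_iff)
  have "2 * (2 * k + 1) * (i - 1) + 2 * (2 * k + 1) * 0 + 2 * (2 * k + 1)
      \<le> 2 * (2 * m - 1) * (2 * k + 1)"
    using assms by (intro mult_add_le) auto
  then have "2 * (2 * k + 1) * (i - 1) + 2 * (2 * k + 1) \<le> 2 * (2 * m - 1) * (2 * k + 1)"
    by (simp only: mult_0_right add_0_right)
  moreover have "2 * (2 * m - 1) * (2 * k + 1) = 2 * (2 * k + 1) * (2 * m - 1)"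
    by (simp only: ac_simps)
  ultimately show ?thesis
    using zigzag_odd[OF p] unfolding cylinder_label_def prod.case by metis
qed

text \<open>The cut is next to M/2, where M/2 = \<open>(2 * k + 1) * (2 * m - 1)\<close>. The
  extreme labels lie in row \<open>m\<close>: the largest low one is M/2 - 2 and the smallest high
  one M/2 - 1, hence the \<open>+ 1\<close> here and in
  \<open>cylinder_label_odd_ge\<close>.\<close>

lemma cylinder_label_even_less:
  assumes "even (i + j)" "i \<in> {1..m}" "k \<ge> 1"
  shows "cylinder_label k m (i, j) + 1 < (2 * k + 1) * (2 * m - 1)"
proof -
  have "(i + j) mod (4 * k) < 4 * k" using assms by simp
  then have "(i + j) mod (4 * k) div 2 < 2 * k" by simp
  moreover have "2 * (2 * k + 1) * (i - 1) \<le> 2 * (2 * k + 1) * (m - 1)"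
    using assms by (intro mult_le_mono2) auto
  moreover have "2 * (2 * k + 1) * (m - 1) + (2 * k + 1) = (2 * k + 1) * (2 * m - 1)"
    using assms by (cases m) (auto simp: algebra_simps)
  ultimately show ?thesis unfolding cylinder_label_even[OF assms(1)] by linarith
qed

lemma cylinder_label_odd_ge:
  assumes "odd (i + j)" "i \<in> {1..m}" "k \<ge> 1"
  shows "(2 * k + 1) * (2 * m - 1) \<le> cylinder_label k m (i, j) + 1"
proof -
  have "(i + j) mod (4 * k) < 4 * k" using assms by simp
  then have "(i + j) mod (4 * k) div 2 < 2 * k" by simp
  moreover have "2 * (2 * k + 1) * (i - 1) \<le> 2 * (2 * k + 1) * (m - 1)"
    using assms by (intro mult_le_mono2) auto
  moreover have "2 * (2 * k + 1) * (m - 1) + (2 * k + 1) = (2 * k + 1) * (2 * m - 1)"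
    using assms by (cases m) (auto simp: algebra_simps)
  moreover have "2 * (2 * k + 1) * (2 * m - 1) =
      (2 * k + 1) * (2 * m - 1) + (2 * k + 1) * (2 * m - 1)"
    by (metis mult_2 mult.assoc)
  ultimately show ?thesis using cylinder_label_odd[OF assms] by (simp only: split: if_splits)
qed

lemma cylinder_label_less:
  assumes "even (i + j)" "odd (i' + j')" "i \<in> {1..m}" "i' \<in> {1..m}" "k \<ge> 1"
  shows "cylinder_label k m (i, j) < cylinder_label k m (i', j')"
  using cylinder_label_even_less[OF assms(1,3,5)] cylinder_label_odd_ge[OF assms(2,4,5)]
  by linarith

lemma mult_add_inj:
  fixes c x x' y y' :: nat
  assumes "c * x + y = c * x' + y'" "y < c" "y' < c"
  shows "x = x' \<and> y = y'"
proof -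
  have "(c * x + y) div c = (c * x' + y') div c" "(c * x + y) mod c = (c * x' + y') mod c"
    using assms(1) by simp_all
  then show ?thesis using assms(2,3) by simp
qed

text \<open>The cut separates the parities. Within one parity, the label or its distance from M has
  the form \<open>2 * (2 * k + 1) * (i - 1)\<close> plus a remainder, so division recovers the row,
  then the position and the column.\<close>

lemma inj_on_cylinder_label:
  assumes "k \<ge> 1"
  shows "inj_on (cylinder_label k m) (cycle_path_verts (4 * k) m)"
proof (rule inj_onI, clarify)
  fix i j i' j'
  assume "(i, j) \<in> cycle_path_verts (4 * k) m" "(i', j') \<in> cycle_path_verts (4 * k) m"
    and eq: "cylinder_label k m (i, j) = cylinder_label k m (i', j')"
  then have i: "i \<in> {1..m}" "i' \<in> {1..m}" and j: "j \<in> {1..4 * k}" "j' \<in> {1..4 * k}"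
    by (auto simp: cycle_path_verts_def)
  let ?p = "(i + j) mod (4 * k)" and ?p' = "(i' + j') mod (4 * k)"
  have p: "?p < 4 * k" "?p' < 4 * k" using assms by simp_all
  have half: "?p div 2 < 2 * k" using p(1) by simp
  have half': "?p' div 2 < 2 * k" using p(2) by simp
  have par: "even (i + j) \<longleftrightarrow> even (i' + j')"
    using cylinder_label_less[of i j i' j' m k] cylinder_label_less[of i' j' i j m k] eq i assms
    by auto
  have "i - 1 = i' - 1 \<and> ?p = ?p'"
  proof (cases "even (i + j)")
    case True
    then have ev: "even ?p" "even ?p'" using par by (simp_all add: dvd_mod_iff)
    have "i - 1 = i' - 1 \<and> ?p div 2 = ?p' div 2"
    proof (rule mult_add_inj)
      show "2 * (2 * k + 1) * (i - 1) + ?p div 2 = 2 * (2 * k + 1) * (i' - 1) + ?p' div 2"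
        using cylinder_label_even[of i j k m] cylinder_label_even[of i' j' k m] True par eq
        by simp
    qed (rule less_le_trans[OF half] less_le_trans[OF half'], simp)+
    then show ?thesis using ev by (metis dvd_mult_div_cancel)
  next
    case False
    then have od: "odd ?p" "odd ?p'" using par by (simp_all add: dvd_mod_iff)
    \<comment> \<open>At most \<open>2 * k + 2\<close>, which is below the divisor
      \<open>2 * (2 * k + 1)\<close> because \<open>k \<ge> 1\<close>.\<close>
    define s where "s = ?p div 2 + (if ?p < 2 * k then 1 else 3)"
    define s' where "s' = ?p' div 2 + (if ?p' < 2 * k then 1 else 3)"
    have "i - 1 = i' - 1 \<and> s = s'"
    proof (rule mult_add_inj)
      show "2 * (2 * k + 1) * (i - 1) + s = 2 * (2 * k + 1) * (i' - 1) + s'"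
        using cylinder_label_odd[OF _ i(1) assms, of j] cylinder_label_odd[OF _ i(2) assms, of j']
          False par eq unfolding s_def s'_def by simp
    qed (use half half' assms in \<open>simp_all add: s_def s'_def del: div_less\<close>)
    moreover have "?p = ?p'" if "s = s'"
      using odd_position_eq[OF od] that unfolding s_def s'_def .
    ultimately show ?thesis by blast
  qed
  then have "i = i'" "?p = ?p'" using i by auto
  then show "i = i' \<and> j = j'" using cycle_position_inj[OF j] by auto
qed

section \<open>Differences along the edges\<close>

text \<open>The two equal offsets add up to an even multiple of \<open>2 * (2 * k + 1)\<close>;
  joining edges give the odd multiples.\<close>

lemma cylinder_label_horizontal:
  assumes "k \<ge> 1" "i \<in> {1..m}"
  shows "\<bar>int (cylinder_label k m (i, j)) - int (cylinder_label k m (i, j mod (4 * k) + 1))\<bar> =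
    int (2 * (2 * m - 1) * (2 * k + 1) - 2 * (2 * k + 1) * (2 * (i - 1))
      - zigzag_gap k ((i + j) mod (4 * k)))"
proof -
  let ?a = "2 * (2 * k + 1) * (i - 1)"
  have sum: "?a + ?a = 2 * (2 * k + 1) * (2 * (i - 1))" by simp
  have le: "?a + ?a + 2 * (2 * k + 1) \<le> 2 * (2 * m - 1) * (2 * k + 1)"
    using assms by (intro mult_add_le) auto
  have p: "(i + j) mod (4 * k) < 4 * k" using assms by simp
  have step: "(i + (j mod (4 * k) + 1)) mod (4 * k) = ((i + j) mod (4 * k) + 1) mod (4 * k)"
    by (metis (no_types, lifting) add.assoc mod_add_left_eq mod_add_right_eq)
  show ?thesis
    using zigzag_diff[OF p le] unfolding cylinder_label_def prod.case step sum .
qed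

lemma cylinder_label_vertical:
  assumes "k \<ge> 1" "i \<in> {1..m - 1}"
  shows "\<bar>int (cylinder_label k m (i, j)) - int (cylinder_label k m (i + 1, j))\<bar> =
    int (2 * (2 * m - 1) * (2 * k + 1) - 2 * (2 * k + 1) * (2 * (i - 1) + 1)
      - zigzag_gap k ((i + j) mod (4 * k)))"
proof -
  let ?a = "2 * (2 * k + 1) * (i - 1)" and ?b = "2 * (2 * k + 1) * i"
  have sum: "?a + ?b = 2 * (2 * k + 1) * (2 * (i - 1) + 1)"
    using assms by (cases i) (auto simp: algebra_simps)
  have le: "?a + ?b + 2 * (2 * k + 1) \<le> 2 * (2 * m - 1) * (2 * k + 1)"
    using assms by (intro mult_add_le) auto
  have p: "(i + j) mod (4 * k) < 4 * k" using assms by simp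
  have step: "(i + 1 + j) mod (4 * k) = ((i + j) mod (4 * k) + 1) mod (4 * k)"
    by (simp add: mod_Suc_eq)
  show ?thesis
    using zigzag_diff[OF p le]
    unfolding cylinder_label_def prod.case step sum add_diff_cancel_right' .
qed

lemma cylinder_label_differences:
  assumes "k \<ge> 1" "m \<ge> 1"
  shows "{\<bar>int (cylinder_label k m x) - int (cylinder_label k m y)\<bar> | x y.
      {x, y} \<in> cycle_path_edges (4 * k) m} =
    int ` ({1..2 * (2 * m - 1) * (2 * k + 1)} - {i * (2 * k + 1) | i. i \<in> {1..2 * (2 * m - 1)}})"
    (is "?L = int ` ?R")
proof -
  let ?D = "\<lambda>r s. 2 * (2 * m - 1) * (2 * k + 1) - 2 * (2 * k + 1) * r - s"
  \<comment> \<open>For Q = \<open>2 * k + 1\<close> the gaps are exactly the remainders from 1 to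
    2Q - 1 other than Q.\<close>
  have R: "?R = {?D r s | r s. r < 2 * m - 1 \<and> s \<in> zigzag_gap k ` {..<4 * k}}"
    using non_multiples_eq[of "2 * k + 1" "2 * m - 1"] zigzag_gap_image[OF assms(1)]
    by (simp add: ac_simps)
  have mem: "int (?D r (zigzag_gap k (i mod (4 * k)))) \<in> int ` ?R" if "r < 2 * m - 1" for r i
  proof -
    have "i mod (4 * k) \<in> {..<4 * k}" using assms(1) by simp
    then show ?thesis unfolding R using that by blast
  qed
  have "?L \<subseteq> int ` ?R"
  proof
    fix v assume "v \<in> ?L"
    then obtain x y where v: "v = \<bar>int (cylinder_label k m x) - int (cylinder_label k m y)\<bar>"
      and "{x, y} \<in> cycle_path_edges (4 * k) m" by blast
    then consider
        (hor) i j where "i \<in> {1..m}" "{x, y} = {(i, j), (i, j mod (4 * k) + 1)}"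
      | (ver) i j where "i \<in> {1..m - 1}" "{x, y} = {(i, j), (i + 1, j)}"
      unfolding cycle_path_edges_def by blast
    then show "v \<in> int ` ?R"
    proof cases
      case hor
      then have "v = int (?D (2 * (i - 1)) (zigzag_gap k ((i + j) mod (4 * k))))"
        using cylinder_label_horizontal[OF assms(1) hor(1), of j] v
        unfolding doubleton_eq_iff by (metis abs_minus_commute)
      moreover have "2 * (i - 1) < 2 * m - 1" using hor(1) by auto
      ultimately show ?thesis using mem by (simp only:)
    next
      case ver
      then have "v = int (?D (2 * (i - 1) + 1) (zigzag_gap k ((i + j) mod (4 * k))))"
        using cylinder_label_vertical[OF assms(1) ver(1), of j] v
        unfolding doubleton_eq_iff by (metis abs_minus_commute)
      moreover have "2 * (i - 1) + 1 < 2 * m - 1" using ver(1) by auto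
      ultimately show ?thesis using mem by (simp only:)
    qed
  qed
  moreover have "int ` ?R \<subseteq> ?L"
  proof
    fix v assume "v \<in> int ` ?R"
    then obtain r p where v: "v = int (?D r (zigzag_gap k p))" and r: "r < 2 * m - 1"
      and p: "p < 4 * k" unfolding R by blast
    \<comment> \<open>Half of \<open>r\<close> fixes the row and its parity the kind of edge; the
      column is then chosen to hit position \<open>p\<close>.\<close>
    define i where "i = r div 2 + 1"
    obtain j where j: "j \<in> {1..4 * k}" "(i + j) mod (4 * k) = p"
      using ex_cycle_position[OF p] by blast
    show "v \<in> ?L"
    proof (cases "even r")
      case True
      then have i: "i \<in> {1..m}" "r = 2 * (i - 1)" using r unfolding i_def by auto
      then have "{(i, j), (i, j mod (4 * k) + 1)} \<in> cycle_path_edges (4 * k) m"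
        using j unfolding cycle_path_edges_def by blast
      moreover have "v = \<bar>int (cylinder_label k m (i, j)) - int (cylinder_label k m (i, j mod (4 * k) + 1))\<bar>"
        unfolding v cylinder_label_horizontal[OF assms(1) i(1)] j(2) i(2)[symmetric] ..
      ultimately show ?thesis by blast
    next
      case False
      then have i: "i \<in> {1..m - 1}" "r = 2 * (i - 1) + 1"
        using r unfolding i_def by (auto elim!: oddE)
      then have "{(i, j), (i + 1, j)} \<in> cycle_path_edges (4 * k) m"
        using j unfolding cycle_path_edges_def by blast
      moreover have "v = \<bar>int (cylinder_label k m (i, j)) - int (cylinder_label k m (i + 1, j))\<bar>"
        unfolding v cylinder_label_vertical[OF assms(1) i(1)] j(2) i(2)[symmetric] ..
      ultimately show ?thesis by blast
    qed
  qed
  ultimately show ?thesis by blast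
qed

section \<open>Bipartition and conclusion\<close>

text \<open>Evenness of \<open>n\<close> makes the parity change also on the closing edge from
  \<open>n\<close> to 1.\<close>

lemma bipartition_cycle_path:
  assumes "even n" "n > 0"
  shows "bipartition (cycle_path_verts n m) (cycle_path_edges n m)
    {(i, j) \<in> cycle_path_verts n m. even (i + j)} {(i, j) \<in> cycle_path_verts n m. odd (i + j)}"
    (is "bipartition ?V ?E ?A ?B")
proof -
  have split: "\<exists>a\<in>?A. \<exists>b\<in>?B. {(i, j), (i', j')} = {a, b}"
    if "(i, j) \<in> ?V" "(i', j') \<in> ?V" "even (i + j) \<longleftrightarrow> odd (i' + j')" for i j i' j'
  proof (cases "even (i + j)")
    case True
    then have "(i, j) \<in> ?A" "(i', j') \<in> ?B" using that by auto
    then show ?thesis by blast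
  next
    case False
    then have "(i', j') \<in> ?A" "(i, j) \<in> ?B" using that by auto
    then show ?thesis by blast
  qed
  have next_in: "j mod n + 1 \<in> {1..n}" for j
    using assms by (simp add: Suc_le_eq)
  have "\<exists>a\<in>?A. \<exists>b\<in>?B. e = {a, b}" if "e \<in> ?E" for e
  proof -
    from that consider
        (hor) i j where "i \<in> {1..m}" "j \<in> {1..n}" "e = {(i, j), (i, j mod n + 1)}"
      | (ver) i j where "i \<in> {1..m - 1}" "j \<in> {1..n}" "e = {(i, j), (i + 1, j)}"
      unfolding cycle_path_edges_def by blast
    then show ?thesis
    proof cases
      case hor
      show ?thesis unfolding hor(3)
        by (rule split) (use hor next_in[of j] assms in \<open>auto simp: cycle_path_verts_def dvd_mod_iff\<close>)
    next
      case ver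
      show ?thesis unfolding ver(3)
        by (rule split) (use ver in \<open>auto simp: cycle_path_verts_def\<close>)
    qed
  qed
  then show ?thesis unfolding bipartition_def by auto
qed

theorem theorem3p3:
  fixes k m :: nat
  assumes "k \<ge> 1" and "m \<ge> 2"
  shows "\<exists>f. divisible_graceful_alpha_labeling (2 * (2 * m - 1))
           (cycle_path_verts (4 * k) m) (cycle_path_edges (4 * k) m) f"
proof -
  let ?V = "cycle_path_verts (4 * k) m" and ?E = "cycle_path_edges (4 * k) m"
  let ?f = "cylinder_label k m"
  let ?A = "{(i, j) \<in> ?V. even (i + j)}" and ?B = "{(i, j) \<in> ?V. odd (i + j)}"
  let ?M = "2 * (2 * m - 1) * (2 * k + 1)" and ?h = "(2 * k + 1) * (2 * m - 1)"
  have low: "?f x + 1 < ?h" if "x \<in> ?A" for x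
    using that cylinder_label_even_less[OF _ _ assms(1)] by (auto simp: cycle_path_verts_def)
  have high: "?h \<le> ?f x + 1" if "x \<in> ?B" for x
    using that cylinder_label_odd_ge[OF _ _ assms(1)] by (auto simp: cycle_path_verts_def)
  have "?f x \<le> ?M - 1" if x: "x \<in> ?V" for x
  proof -
    obtain i j where ij: "x = (i, j)" "i \<in> {1..m}" using x by (auto simp: cycle_path_verts_def)
    have "?h \<le> ?M" by simp
    show ?thesis
    proof (cases "even (i + j)")
      case True
      then have "?f x + 1 < ?h" using low x ij by simp
      then show ?thesis using \<open>?h \<le> ?M\<close> by linarith
    next
      case False
      \<comment> \<open>The summand 1 or 3 in \<open>cylinder_label_odd\<close> keeps high labels
        strictly below \<open>?M\<close>.\<close>
      then have "?f (i, j) + 1 \<le> 2 * (2 * k + 1) * (2 * m - 1)"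
        using cylinder_label_odd[OF False ij(2) assms(1)] by (simp only: split: if_splits)
      also have "2 * (2 * k + 1) * (2 * m - 1) = ?M" by (simp only: ac_simps)
      finally show ?thesis unfolding ij(1) by linarith
    qed
  qed
  then have range: "?f ` ?V \<subseteq> {0..?M - 1}" by auto
  have "divisible_graceful_labeling (2 * (2 * m - 1)) ?V ?E ?f"
    unfolding divisible_graceful_labeling_def
  \<comment> \<open>Here q = \<open>2 * k\<close>, so q + 1 is the modulus Q and d(q + 1) =
    \<open>?M\<close>.\<close>
  proof (intro conjI exI[of _ "2 * k"])
    show "card ?E = 2 * (2 * m - 1) * (2 * k)"
      using card_cycle_path_edges[of "4 * k" m] assms by simp
  qed (use assms simple_graph_cycle_path[of "4 * k" m] inj_on_cylinder_label range
      cylinder_label_differences[of k m] in auto)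
  moreover have "Max (?f ` ?A) < Min (?f ` ?B)"
  proof -
    have fin: "finite ?A" "finite ?B"
      by (rule finite_subset[of _ ?V]; auto simp: cycle_path_verts_def)+
    \<comment> \<open>Nonemptiness matters because \<open>Max\<close> and \<open>Min\<close> are
      unspecified on the empty set.\<close>
    have "(1, 1) \<in> ?A" "(1, 2) \<in> ?B" using assms by (auto simp: cycle_path_verts_def)
    then have "?A \<noteq> {}" "?B \<noteq> {}" by blast+
    moreover have "?f a < ?f b" if "a \<in> ?A" "b \<in> ?B" for a b
      using low[OF that(1)] high[OF that(2)] by linarith
    ultimately show ?thesis using fin by (subst Max_less_iff; simp)
  qed
  moreover have "bipartition ?V ?E ?A ?B"
    using assms by (intro bipartition_cycle_path) auto
  ultimately show ?thesis unfolding divisible_graceful_alpha_labeling_def by blast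
qed

end
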